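(* Let $r=\{r(k)\}_{k\ge 0}$ and $s=\{s(k)\}_{k\ge 0}$ be time-homogeneous Markov chains with values in $[N]$ and $[M]$, with transition probability matrices $P=[p_{ij}]\in\mathbb{R}^{N\times N}$ and $Q=[q_{ij}]\in\mathbb{R}^{M\times M}$, respectively, and constant initial states $r(0)=r_0\in[N]$, $s(0)=s_0\in[M]$. Let $\Lambda\subset[M]$ be nonempty and recurrent for $s$, let $t=t_\Lambda(s)$ be the observation process induced by $s$ and $\Lambda$, and let $\tau$, $\sigma$ be the associated processes (with an arbitrary integer $\tau_0<0$ and an arbitrary $\sigma_0\in[N]$). Let $T$ be a positive integer and define $$\bar{\mathfrak X}=[N]\times[M]\times[N]\times[T].$$ Then the $\bar{\mathfrak X}$-valued stochastic process $\bar r$ defined by $$\bar r(k)=\bigl(r(k),\,s(k),\,\sigma(k),\,\lfloor k+1-\tau(k)\rfloor_T\bigr),\qquad k\ge 0,$$ is a time-homogeneous Markov chain. Moreover its transition probabilities are given by, for all $\chi=(\alpha,\beta,\gamma,\delta)$ and $\chi'=(\alpha',\beta',\gamma',\delta')$ in $\bar{\mathfrak X}$, $$\mathcal P(\bar r(k+1)=\chi'\mid \bar r(k)=\chi)=\begin{cases}\mathbf 1(\alpha'=\gamma',\ \delta'=1)\,p_{\alpha,\alpha'}\,q_{\beta,\beta'} & \text{if }\beta'\in\Lambda,\\ \mathbf 1(\gamma'=\gamma,\ \delta'=\lfloor\delta+1\rfloor_T)\,p_{\alpha,\alpha'}\,q_{\beta,\beta'} & \text{if }\beta'\notin\Lam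bda.\end{cases}$$
   Context: Notation: $[N]=\{1,\dots,N\}$ for a positive integer $N$; $\mathbb N$ is the set of nonnegative integers; $N,M,T$ are positive integers. For an integer $k$, $\lfloor k\rfloor_T$ is the unique integer in $[T]$ such that $k-\lfloor k\rfloor_T$ is an integer multiple of $T$. $\mathbf 1(\cdot)$ equals $1$ if the stated condition holds and $0$ otherwise. $\mathcal P$ denotes probability; conditional probabilities are considered only when the conditioning event has positive probability. Induced observation process: a subset $\Lambda\subset[M]$ is recurrent for $s$ in the sense that, from every initial state $s_0\in[M]$, with probability one $s(k)\in\Lambda$ for infinitely many $k$. Then $t_\Lambda(s)=\{t_i\}_{i\ge 0}$ denotes the sequence obtained by listing in increasing order the elements of the (almost surely infinite) set $\{k\in\mathbb N: s(k)\in\Lambda\}$. Associated processes: for $t=\{t_i\}_{i\ge0}$, an integer $\tau_0<0$ and $\sigma_0\in[N]$, set $\tau(k)=\max\{t_i: t_i\le k\}$ if $k\ge \max(0,t_0)$ and $\tau(k)=\tau_0$ otherwise; and $\sigma(k)=r(\tau(k))$ if $k\ge\max(0,t_0)$ and $\sigma(k)=\sigma_0$ otherwise.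
   Formalization: The chains r and s are additionally assumed independent; without this the transition formula fails (e.g. r = s with all p_ij = q_ij = 1/2, Λ = [2]), and independence is in fact necessary for the stated conclusion. *)

theory Defs
  imports "HOL-Probability.Probability"
begin

text \<open>
  The interval \<open>[n] = {1, \<dots>, n}\<close> is \<open>{1..n} :: nat set\<close>, and a matrix indexed by a set \<open>S\<close> of
  states is a function of two states, only its values on \<open>S\<close> being relevant.
\<close>

definition time_homogeneous_markov_chain ::
    "'w measure \<Rightarrow> 'a set \<Rightarrow> (nat \<Rightarrow> 'w \<Rightarrow> 'a) \<Rightarrow> bool" where
  "time_homogeneous_markov_chain \<Omega> S X \<longleftrightarrow>
     (\<forall>k. X k \<in> measurable \<Omega> (count_space S)) \<and>
     (\<forall>k x. \<forall>y\<in>S. \<P>(\<omega> in \<Omega>. \<forall>i\<le>k. X i \<omega> = x i) > 0 \<longrightarrow>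
        \<P>(\<omega> in \<Omega>. X (Suc k) \<omega> = y \<bar> \<forall>i\<le>k. X i \<omega> = x i) =
        \<P>(\<omega> in \<Omega>. X (Suc k) \<omega> = y \<bar> X k \<omega> = x k)) \<and>
     (\<forall>k l. \<forall>x\<in>S. \<forall>y\<in>S.
        \<P>(\<omega> in \<Omega>. X k \<omega> = x) > 0 \<longrightarrow> \<P>(\<omega> in \<Omega>. X l \<omega> = x) > 0 \<longrightarrow>
        \<P>(\<omega> in \<Omega>. X (Suc k) \<omega> = y \<bar> X k \<omega> = x) =
        \<P>(\<omega> in \<Omega>. X (Suc l) \<omega> = y \<bar> X l \<omega> = x))"

definition stochastic_matrix :: "'a set \<Rightarrow> ('a \<Rightarrow> 'a \<Rightarrow> real) \<Rightarrow> bool" where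
  "stochastic_matrix S P \<longleftrightarrow>
     (\<forall>i\<in>S. \<forall>j\<in>S. 0 \<le> P i j) \<and> (\<forall>i\<in>S. (\<Sum>j\<in>S. P i j) = 1)"

definition has_transition_probs ::
    "'w measure \<Rightarrow> 'a set \<Rightarrow> (nat \<Rightarrow> 'w \<Rightarrow> 'a) \<Rightarrow> ('a \<Rightarrow> 'a \<Rightarrow> real) \<Rightarrow> bool" where
  "has_transition_probs \<Omega> S X P \<longleftrightarrow>
     (\<forall>k. \<forall>i\<in>S. \<forall>j\<in>S. \<P>(\<omega> in \<Omega>. X k \<omega> = i) > 0 \<longrightarrow>
        \<P>(\<omega> in \<Omega>. X (Suc k) \<omega> = j \<bar> X k \<omega> = i) = P i j)"

definition markov_chain_from ::
    "'w measure \<Rightarrow> 'a set \<Rightarrow> ('a \<Rightarrow> 'a \<Rightarrow> real) \<Rightarrow> 'a \<Rightarrow> (nat \<Rightarrow> 'w \<Rightarrow> 'a) \<Rightarrow> bool" where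
  "markov_chain_from \<Omega> S P x0 X \<longleftrightarrow>
     time_homogeneous_markov_chain \<Omega> S X \<and> stochastic_matrix S P \<and>
     has_transition_probs \<Omega> S X P \<and> x0 \<in> S \<and> (AE \<omega> in \<Omega>. X 0 \<omega> = x0)"

text \<open>
  Recurrence involves all initial states, so it is a property of the transition matrix rather than
  of one particular chain. It is tested on chains living on probability spaces whose sample points
  are sequences of states; this is no restriction, since every chain has its law on such a space.
\<close>

definition recurrent_set :: "nat set \<Rightarrow> (nat \<Rightarrow> nat \<Rightarrow> real) \<Rightarrow> nat set \<Rightarrow> bool" where
  "recurrent_set S Q \<Lambda> \<longleftrightarrow>
     (\<forall>x0\<in>S. \<forall>(\<mu> :: (nat \<Rightarrow> nat) measure) X.
        prob_space \<mu> \<longrightarrow> markov_chain_from \<mu> S Q x0 X \<longrightarrow>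
        (AE \<omega> in \<mu>. infinite {k. X k \<omega> \<in> \<Lambda>}))"

text \<open>
  On the null event where the set of observation times is finite, \<^const>\<open>enumerate\<close> eventually takes
  an unspecified constant value.
\<close>

definition obs_times :: "nat set \<Rightarrow> (nat \<Rightarrow> 'w \<Rightarrow> nat) \<Rightarrow> 'w \<Rightarrow> nat \<Rightarrow> nat" where
  "obs_times \<Lambda> s \<omega> = enumerate {k. s k \<omega> \<in> \<Lambda>}"

definition last_obs_time :: "int \<Rightarrow> (nat \<Rightarrow> nat) \<Rightarrow> nat \<Rightarrow> int" where
  "last_obs_time \<tau>0 t k = (if k \<ge> max 0 (t 0) then int (Max {t i | i. t i \<le> k}) else \<tau>0)"

definition last_obs_state ::
    "int \<Rightarrow> 'a \<Rightarrow> (nat \<Rightarrow> nat) \<Rightarrow> (nat \<Rightarrow> 'a) \<Rightarrow> nat \<Rightarrow> 'a" where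
  "last_obs_state \<tau>0 \<sigma>0 t r k =
     (if k \<ge> max 0 (t 0) then r (nat (last_obs_time \<tau>0 t k)) else \<sigma>0)"

definition residue_in :: "nat \<Rightarrow> int \<Rightarrow> nat" where
  "residue_in T k = (THE j. j \<in> {1..T} \<and> int T dvd (k - int j))"

lemma residue_in_unique:
  assumes "T > 0"
  shows "\<exists>!j. j \<in> {1..T} \<and> int T dvd (k - int j)"
proof (rule ex1I)
  define j where "j = nat ((k - 1) mod int T) + 1"
  have m: "0 \<le> (k - 1) mod int T" "(k - 1) mod int T < int T"
    using assms by auto
  then have "k - int j = (k - 1) - (k - 1) mod int T"
    by (simp add: j_def)
  then have "int T dvd (k - int j)"
    by (metis dvd_minus_mod)
  with m show "j \<in> {1..T} \<and> int T dvd (k - int j)"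
    by (auto simp: j_def)
  fix i assume i: "i \<in> {1..T} \<and> int T dvd (k - int i)"
  have "int T dvd (k - 1) - (int i - 1)"
    using i by simp
  then have "(k - 1) mod int T = (int i - 1) mod int T"
    by (simp add: mod_eq_dvd_iff)
  also have "\<dots> = int i - 1"
    using i by simp
  finally show "i = j"
    using i by (simp add: j_def nat_diff_distrib)
qed

definition extended_process ::
    "nat \<Rightarrow> int \<Rightarrow> nat \<Rightarrow> nat set \<Rightarrow> (nat \<Rightarrow> 'w \<Rightarrow> nat) \<Rightarrow> (nat \<Rightarrow> 'w \<Rightarrow> nat) \<Rightarrow>
     nat \<Rightarrow> 'w \<Rightarrow> nat \<times> nat \<times> nat \<times> nat" where
  "extended_process T \<tau>0 \<sigma>0 \<Lambda> r s k \<omega> =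
     (let t = obs_times \<Lambda> s \<omega>;
          \<tau> = last_obs_time \<tau>0 t;
          \<sigma> = last_obs_state \<tau>0 \<sigma>0 t (\<lambda>l. r l \<omega>)
      in (r k \<omega>, s k \<omega>, \<sigma> k, residue_in T (int k + 1 - \<tau> k)))"

end

theory Submission
  imports Defs
begin

text \<open>
  The extended process is driven by a deterministic recursion: its state at
  time \<open>k + 1\<close> is a function of its state at time \<open>k\<close> and of the new values
  \<open>r (k + 1)\<close> and \<open>s (k + 1)\<close> (\<open>extended_process_0\<close>, \<open>extended_process_Suc\<close>). Since it also shows \<open>r k\<close>
  and \<open>s k\<close> as components, prescribing its history up to time \<open>k\<close> amounts to prescribing the
  histories of \<open>r\<close> and \<open>s\<close>, provided the prescribed states respect the recursion; otherwise the
  event is null. By independence, the probability of such a history is the product of the path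
  probabilities of \<open>r\<close> and \<open>s\<close>. Lengthening the history by one step thus multiplies its probability by
  a transition probability of \<open>r\<close>, one of \<open>s\<close>, and the indicator that the new state is the updated
  one, which is the claimed transition kernel.

  For a process with finitely many states, this multiplicativity of path probabilities is equivalent
  to being a Markov chain with that kernel (\<open>markov_chain_of_path_probs\<close>, \<open>path_prob_Suc\<close>), so it
  serves both to exploit the assumptions and to conclude.

  The recursion needs infinitely many observations. Recurrence gives this almost surely after
  passing to the law of \<open>s\<close> (\<open>recurrent_set_AE_infinite\<close>), whereas measurability has to be established
  also on the exceptional null set (\<open>measurable_extended_process\<close>).
\<close>

section \<open>Markov chains and path probabilities\<close>

lemma pred_eq_const_count_space:
  assumes "f \<in> measurable \<Omega> (count_space S)"
  shows "Measurable.pred \<Omega> (\<lambda>\<omega>. f \<omega> = c)"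
  by (rule measurable_compose[OF assms]) simp

lemma markov_chain_from_measurable:
  assumes "markov_chain_from \<Omega> S P x0 X"
  shows "X k \<in> measurable \<Omega> (count_space S)"
  using assms by (simp add: markov_chain_from_def time_homogeneous_markov_chain_def)

lemma markov_chain_from_path_measurable:
  assumes "markov_chain_from \<Omega> S P x0 X"
  shows "(\<lambda>\<omega> k. X k \<omega>) \<in> measurable \<Omega> (\<Pi>\<^sub>M k\<in>UNIV. count_space S)"
  using measurable_space[OF markov_chain_from_measurable[OF assms]]
  by (intro measurable_PiM_single' markov_chain_from_measurable[OF assms]) auto

text \<open>
  Multiplicativity of path probabilities yields the Markov property directly. The transition
  probability conditioned on the present alone follows because the event \<open>X k = x\<close> splits into the
  finitely many histories ending in \<open>x\<close>, each of which contributes the same factor \<open>K x y\<close>.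
\<close>
lemma (in prob_space) markov_chain_of_path_probs:
  fixes X :: "nat \<Rightarrow> 'a \<Rightarrow> 'b"
  assumes fin: "finite S"
    and X: "\<And>k. X k \<in> measurable M (count_space S)"
    and path: "\<And>k x. (\<And>i. i \<le> Suc k \<Longrightarrow> x i \<in> S) \<Longrightarrow>
      \<P>(\<omega> in M. \<forall>i\<le>Suc k. X i \<omega> = x i) = \<P>(\<omega> in M. \<forall>i\<le>k. X i \<omega> = x i) * K (x k) (x (Suc k))"
  shows "time_homogeneous_markov_chain M S X \<and> has_transition_probs M S X K"
proof -
  note [measurable] = pred_eq_const_count_space[OF X]
  have in_S: "X k \<omega> \<in> S" if "\<omega> \<in> space M" for k \<omega>
    using measurable_space[OF X that] by simp
  have path': "\<P>(\<omega> in M. X (Suc k) \<omega> = y \<and> (\<forall>i\<le>k. X i \<omega> = x i)) =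
      \<P>(\<omega> in M. \<forall>i\<le>k. X i \<omega> = x i) * K (x k) y"
    if "\<And>i. i \<le> k \<Longrightarrow> x i \<in> S" "y \<in> S" for k x y
  proof -
    let ?x = "x(Suc k := y)"
    have "{\<omega> \<in> space M. \<forall>i\<le>Suc k. X i \<omega> = ?x i} =
        {\<omega> \<in> space M. X (Suc k) \<omega> = y \<and> (\<forall>i\<le>k. X i \<omega> = x i)}"
      by (auto simp: le_Suc_eq)
    moreover have "{\<omega> \<in> space M. \<forall>i\<le>k. X i \<omega> = ?x i} = {\<omega> \<in> space M. \<forall>i\<le>k. X i \<omega> = x i}"
      by auto
    moreover have "?x i \<in> S" if "i \<le> Suc k" for i
      using \<open>\<And>i. i \<le> k \<Longrightarrow> x i \<in> S\<close> \<open>y \<in> S\<close> that by (auto simp: le_Suc_eq)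
    from path[of k ?x, OF this] have "\<P>(\<omega> in M. \<forall>i\<le>Suc k. X i \<omega> = ?x i) =
        \<P>(\<omega> in M. \<forall>i\<le>k. X i \<omega> = ?x i) * K (x k) y"
      by simp
    ultimately show ?thesis
      by simp
  qed
  have split: "\<P>(\<omega> in M. A \<omega> \<and> X k \<omega> = x) =
      (\<Sum>w\<in>{w \<in> {..k} \<rightarrow>\<^sub>E S. w k = x}. \<P>(\<omega> in M. A \<omega> \<and> (\<forall>i\<le>k. X i \<omega> = w i)))"
    if [measurable]: "Measurable.pred M A" for A k x
  proof -
    let ?W = "{w \<in> {..k} \<rightarrow>\<^sub>E S. w k = x}"
    let ?E = "\<lambda>w. {\<omega> \<in> space M. A \<omega> \<and> (\<forall>i\<le>k. X i \<omega> = w i)}"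
    have "{\<omega> \<in> space M. A \<omega> \<and> X k \<omega> = x} = (\<Union>w\<in>?W. ?E w)" (is "?L = _")
    proof
      show "?L \<subseteq> (\<Union>w\<in>?W. ?E w)"
      proof
        fix \<omega> assume \<omega>: "\<omega> \<in> ?L"
        then have "restrict (\<lambda>i. X i \<omega>) {..k} \<in> ?W" "\<omega> \<in> ?E (restrict (\<lambda>i. X i \<omega>) {..k})"
          by (auto simp: in_S)
        then show "\<omega> \<in> (\<Union>w\<in>?W. ?E w)"
          by blast
      qed
    qed auto
    moreover have "disjoint_family_on ?E ?W"
      unfolding disjoint_family_on_def
    proof (intro ballI impI)
      fix v w assume vw: "v \<in> ?W" "w \<in> ?W" "v \<noteq> w"
      then obtain i where "i \<le> k" "v i \<noteq> w i"
        by (metis (no_types, lifting) PiE_ext atMost_iff mem_Collect_eq)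
      then show "?E v \<inter> ?E w = {}"
        by force
    qed
    moreover have "finite ?W"
      using fin by (intro finite_subset[OF _ finite_PiE[of "{..k}" "\<lambda>_. S"]]) auto
    moreover have "?E ` ?W \<subseteq> events"
      by auto
    ultimately show ?thesis
      by (simp add: finite_measure_finite_Union)
  qed
  have one_step: "\<P>(\<omega> in M. X (Suc k) \<omega> = y \<and> X k \<omega> = x) = \<P>(\<omega> in M. X k \<omega> = x) * K x y"
    if "x \<in> S" "y \<in> S" for k x y
  proof -
    let ?W = "{w \<in> {..k} \<rightarrow>\<^sub>E S. w k = x}"
    have "\<P>(\<omega> in M. X (Suc k) \<omega> = y \<and> X k \<omega> = x) =
        (\<Sum>w\<in>?W. \<P>(\<omega> in M. X (Suc k) \<omega> = y \<and> (\<forall>i\<le>k. X i \<omega> = w i)))"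
      by (rule split) measurable
    also have "\<dots> = (\<Sum>w\<in>?W. \<P>(\<omega> in M. True \<and> (\<forall>i\<le>k. X i \<omega> = w i)) * K x y)"
      using that by (intro sum.cong) (auto simp: path' PiE_iff)
    also have "\<dots> = \<P>(\<omega> in M. True \<and> X k \<omega> = x) * K x y"
      unfolding sum_distrib_right[symmetric] by (subst split) simp_all
    finally show ?thesis by simp
  qed
  have trans: "has_transition_probs M S X K"
    by (simp add: has_transition_probs_def cond_prob_def one_step)
  moreover have "time_homogeneous_markov_chain M S X"
    unfolding time_homogeneous_markov_chain_def
  proof (intro conjI allI ballI impI)
    fix k x y assume y: "y \<in> S" and pos: "0 < \<P>(\<omega> in M. \<forall>i\<le>k. X i \<omega> = x i)"
    from pos have "{\<omega> \<in> space M. \<forall>i\<le>k. X i \<omega> = x i} \<noteq> {}"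
      by (metis less_irrefl measure_empty)
    then obtain \<omega> where "\<omega> \<in> space M" "\<forall>i\<le>k. X i \<omega> = x i"
      by blast
    then have x: "x i \<in> S" if "i \<le> k" for i
      using in_S[of \<omega> i] that by simp
    have "\<P>(\<omega> in M. \<forall>i\<le>k. X i \<omega> = x i) \<le> \<P>(\<omega> in M. X k \<omega> = x k)"
      by (intro finite_measure_mono) auto
    then show "\<P>(\<omega> in M. X (Suc k) \<omega> = y \<bar> \<forall>i\<le>k. X i \<omega> = x i) =
        \<P>(\<omega> in M. X (Suc k) \<omega> = y \<bar> X k \<omega> = x k)"
      using pos x y by (simp add: cond_prob_def path' one_step)
  qed (use X trans in \<open>auto simp: has_transition_probs_def\<close>)
  ultimately show ?thesis by simp
qed

text \<open>
  The converse. Phrased with products instead of conditional probabilities, the statement remains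
  true for histories of probability zero, which removes all case distinctions from its uses.
\<close>
lemma (in prob_space) path_prob_Suc:
  assumes X: "markov_chain_from M S P x0 X"
    and x: "x k \<in> S" "x (Suc k) \<in> S"
  shows "\<P>(\<omega> in M. \<forall>i\<le>Suc k. X i \<omega> = x i) =
    \<P>(\<omega> in M. \<forall>i\<le>k. X i \<omega> = x i) * P (x k) (x (Suc k))"
proof -
  have meas: "X k \<in> measurable M (count_space S)" for k
    using X by (rule markov_chain_from_measurable)
  note [measurable] = pred_eq_const_count_space[OF meas]
  let ?p = "\<P>(\<omega> in M. \<forall>i\<le>k. X i \<omega> = x i)"
  have eq: "\<P>(\<omega> in M. \<forall>i\<le>Suc k. X i \<omega> = x i) =
      \<P>(\<omega> in M. X (Suc k) \<omega> = x (Suc k) \<and> (\<forall>i\<le>k. X i \<omega> = x i))"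
    by (rule arg_cong[where f = prob]) (auto simp: le_Suc_eq)
  show ?thesis
  proof (cases "?p = 0")
    case True
    have "\<P>(\<omega> in M. \<forall>i\<le>Suc k. X i \<omega> = x i) \<le> ?p"
      by (intro finite_measure_mono) auto
    with True show ?thesis by (simp add: measure_le_0_iff)
  next
    case False
    then have pos: "?p > 0" by (simp add: zero_less_measure_iff)
    also have "?p \<le> \<P>(\<omega> in M. X k \<omega> = x k)"
      by (intro finite_measure_mono) auto
    finally have "\<P>(\<omega> in M. X (Suc k) \<omega> = x (Suc k) \<bar> X k \<omega> = x k) = P (x k) (x (Suc k))"
      using X x by (simp add: markov_chain_from_def has_transition_probs_def)
    moreover have "\<P>(\<omega> in M. X (Suc k) \<omega> = x (Suc k) \<bar> \<forall>i\<le>k. X i \<omega> = x i) =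
        \<P>(\<omega> in M. X (Suc k) \<omega> = x (Suc k) \<bar> X k \<omega> = x k)"
      using X x pos by (simp add: markov_chain_from_def time_homogeneous_markov_chain_def)
    ultimately show ?thesis
      using pos by (simp add: eq cond_prob_def field_simps)
  qed
qed

section \<open>Recurrence on an arbitrary probability space\<close>

text \<open>
  Recurrence speaks about chains on spaces of sequences. A chain on another probability space is
  compared with the coordinate process under its law, which has the same path probabilities.
\<close>
lemma (in prob_space) markov_chain_from_law:
  assumes fin: "finite S" and X: "markov_chain_from M S P x0 X"
  shows "markov_chain_from (distr M (\<Pi>\<^sub>M k\<in>UNIV. count_space S) (\<lambda>\<omega> k. X k \<omega>)) S P x0 (\<lambda>k w. w k)"
proof -
  let ?C = "\<Pi>\<^sub>M k\<in>(UNIV::nat set). count_space S"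
  let ?D = "distr M ?C (\<lambda>\<omega> k. X k \<omega>)"
  have X_meas: "(\<lambda>\<omega> k. X k \<omega>) \<in> measurable M ?C"
    using X by (rule markov_chain_from_path_measurable)
  interpret D: prob_space ?D
    by (rule prob_space_distr) (rule X_meas)
  have coord: "(\<lambda>w. w k) \<in> measurable ?C (count_space S)" for k
    by (rule measurable_component_singleton) simp
  note [measurable] = pred_eq_const_count_space[OF coord]
  have paths: "\<P>(w in ?D. \<forall>i\<le>k. w i = x i) = \<P>(\<omega> in M. \<forall>i\<le>k. X i \<omega> = x i)" for k x
  proof -
    have "{w \<in> space ?C. \<forall>i\<le>k. w i = x i} \<in> sets ?C"
      by measurable
    then show ?thesis
      using measurable_space[OF X_meas]
      by (auto simp: measure_distr[OF X_meas] intro!: arg_cong[where f = prob])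
  qed
  have "time_homogeneous_markov_chain ?D S (\<lambda>k w. w k) \<and> has_transition_probs ?D S (\<lambda>k w. w k) P"
  proof (rule D.markov_chain_of_path_probs[OF fin])
    show "(\<lambda>w. w k) \<in> measurable ?D (count_space S)" for k
      using coord by simp
    show "\<P>(w in ?D. \<forall>i\<le>Suc k. w i = x i) = \<P>(w in ?D. \<forall>i\<le>k. w i = x i) * P (x k) (x (Suc k))"
      if "\<And>i. i \<le> Suc k \<Longrightarrow> x i \<in> S" for k x
      unfolding paths by (rule path_prob_Suc[OF X]) (simp_all add: that)
  qed
  moreover have "AE w in ?D. w 0 = x0"
    using X by (subst AE_distr_iff[OF X_meas]) (auto simp: markov_chain_from_def)
  ultimately show ?thesis
    using X by (simp add: markov_chain_from_def)
qed

lemma (in prob_space) recurrent_set_AE_infinite: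
  assumes fin: "finite S" and X: "markov_chain_from M S Q x0 X" and rec: "recurrent_set S Q \<Lambda>"
  shows "AE \<omega> in M. infinite {k. X k \<omega> \<in> \<Lambda>}"
proof -
  let ?C = "\<Pi>\<^sub>M k\<in>(UNIV::nat set). count_space S"
  let ?D = "distr M ?C (\<lambda>\<omega> k. X k \<omega>)"
  have X_meas: "(\<lambda>\<omega> k. X k \<omega>) \<in> measurable M ?C"
    using X by (rule markov_chain_from_path_measurable)
  have "AE w in ?D. infinite {k. w k \<in> \<Lambda>}"
    using rec X markov_chain_from_law[OF fin X] prob_space_distr[OF X_meas]
    unfolding recurrent_set_def markov_chain_from_def[of M] by blast
  then show ?thesis
    by (rule AE_distrD[OF X_meas])
qed

section \<open>The recursion satisfied by the extended process\<close>

lemma residue_in_eqI: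
  assumes "T > 0" "j \<in> {1..T}" "int T dvd (k - int j)"
  shows "residue_in T k = j"
  unfolding residue_in_def using residue_in_unique[OF assms(1)] assms(2,3) by blast

lemma residue_in_1:
  assumes "T > 0"
  shows "residue_in T 1 = 1"
  using assms by (intro residue_in_eqI) auto

lemma residue_in_props:
  assumes "T > 0"
  shows "residue_in T k \<in> {1..T}" "int T dvd (k - int (residue_in T k))"
  using theI'[OF residue_in_unique[OF assms, of k]] by (simp_all add: residue_in_def)

lemma residue_in_residue_in_add:
  assumes "T > 0"
  shows "residue_in T (int (residue_in T k) + l) = residue_in T (k + l)"
proof (rule residue_in_eqI[OF assms])
  show "residue_in T (k + l) \<in> {1..T}"
    by (rule residue_in_props[OF assms])
  have "int T dvd (k + l - int (residue_in T (k + l))) - (k - int (residue_in T k))"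
    by (intro dvd_diff residue_in_props[OF assms])
  then show "int T dvd (int (residue_in T k) + l - int (residue_in T (k + l)))"
    by (simp add: algebra_simps)
qed

lemma enumerate_0_le_iff:
  fixes A :: "nat set"
  assumes "infinite A"
  shows "enumerate A 0 \<le> k \<longleftrightarrow> (\<exists>m\<in>A. m \<le> k)"
  using enumerate_in_set[OF assms, of 0] by (auto simp: enumerate_0 intro: Least_le order_trans)

text \<open>
  When there are infinitely many observations, \<^const>\<open>enumerate\<close> produces exactly the observation times,
  so what is known at time \<open>k\<close> depends only on the observations up to \<open>k\<close>. This fails when
  there are finitely many, since the eventual constant value of \<^const>\<open>enumerate\<close> may then enter the maximum.
\<close>
lemma last_obs_time_enumerate:
  assumes "infinite A"
  shows "last_obs_time \<tau>0 (enumerate A) k =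
    (if \<exists>m\<in>A. m \<le> k then int (Max {m \<in> A. m \<le> k}) else \<tau>0)"
proof -
  have "{enumerate A i | i. enumerate A i \<le> k} = {m \<in> A. m \<le> k}"
    using range_enumerate[OF assms] by auto
  then show ?thesis
    using enumerate_0_le_iff[OF assms, of k] by (simp add: last_obs_time_def)
qed

lemma last_obs_state_enumerate:
  assumes "infinite A"
  shows "last_obs_state \<tau>0 \<sigma>0 (enumerate A) r k =
    (if \<exists>m\<in>A. m \<le> k then r (Max {m \<in> A. m \<le> k}) else \<sigma>0)"
  using enumerate_0_le_iff[OF assms, of k]
  by (simp add: last_obs_state_def last_obs_time_enumerate[OF assms])

definition extended_update ::
    "nat \<Rightarrow> nat set \<Rightarrow> nat \<times> nat \<times> nat \<times> nat \<Rightarrow> nat \<Rightarrow> nat \<Rightarrow> nat \<times> nat \<times> nat \<times> nat" where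
  "extended_update T \<Lambda> = (\<lambda>(_, _, \<gamma>, \<delta>) a b.
     if b \<in> \<Lambda> then (a, b, a, 1) else (a, b, \<gamma>, residue_in T (int \<delta> + 1)))"

lemma Max_le_self:
  assumes "k \<in> A"
  shows "Max {m \<in> A. m \<le> (k::nat)} = k"
  using assms by (intro Max_eqI) auto

text \<open>
  Time 0 is an instance of the same update, applied to a fictitious state at time -1 with
  \<open>\<sigma> = \<sigma>0\<close> and counter \<open>(-1) + 1 - \<tau>0\<close> modulo \<open>T\<close>.
\<close>
lemma extended_process_0:
  assumes "T > 0" and inf: "infinite {k. s k \<omega> \<in> \<Lambda>}"
  shows "extended_process T \<tau>0 \<sigma>0 \<Lambda> r s 0 \<omega> =
    extended_update T \<Lambda> (0, 0, \<sigma>0, residue_in T (- \<tau>0)) (r 0 \<omega>) (s 0 \<omega>)"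
  using residue_in_1[OF \<open>T > 0\<close>] Max_le_self[of 0 "{k. s k \<omega> \<in> \<Lambda>}"]
    residue_in_residue_in_add[OF \<open>T > 0\<close>, of "-\<tau>0" 1]
  by (simp add: extended_process_def obs_times_def extended_update_def add.commute
      last_obs_time_enumerate[OF inf] last_obs_state_enumerate[OF inf] Let_def)

text \<open>
  An observation at time \<open>k + 1\<close> resets the last observation time to \<open>k + 1\<close>, which gives
  \<open>\<sigma> = r (k + 1)\<close> and counter \<open>1\<close>; otherwise \<open>\<tau>\<close> and \<open>\<sigma>\<close> do not change, and the counter
  increases by one modulo \<open>T\<close>.
\<close>
lemma extended_process_Suc:
  assumes "T > 0" and inf: "infinite {k. s k \<omega> \<in> \<Lambda>}"
  shows "extended_process T \<tau>0 \<sigma>0 \<Lambda> r s (Suc k) \<omega> =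
    extended_update T \<Lambda> (extended_process T \<tau>0 \<sigma>0 \<Lambda> r s k \<omega>) (r (Suc k) \<omega>) (s (Suc k) \<omega>)"
proof -
  let ?A = "{k. s k \<omega> \<in> \<Lambda>}"
  note defs = extended_process_def obs_times_def extended_update_def Let_def
    last_obs_time_enumerate[OF inf] last_obs_state_enumerate[OF inf]
  show ?thesis
  proof (cases "Suc k \<in> ?A")
    case True
    then show ?thesis
      using residue_in_1[OF \<open>T > 0\<close>] Max_le_self[OF True] by (auto simp: defs)
  next
    case False
    then have "m \<in> ?A \<and> m \<le> Suc k \<longleftrightarrow> m \<in> ?A \<and> m \<le> k" for m
      by (auto simp: le_Suc_eq)
    then have "{m \<in> ?A. m \<le> Suc k} = {m \<in> ?A. m \<le> k}" "(\<exists>m\<in>?A. m \<le> Suc k) \<longleftrightarrow> (\<exists>m\<in>?A. m \<le> k)"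
      by blast+
    moreover have "residue_in T (int (Suc k) + 1 - \<tau>) =
        residue_in T (int (residue_in T (int k + 1 - \<tau>)) + 1)" for \<tau>
      using residue_in_residue_in_add[OF \<open>T > 0\<close>, of "int k + 1 - \<tau>" 1] by (simp add: algebra_simps)
    ultimately show ?thesis
      using False by (simp only: defs prod.case mem_Collect_eq if_False)
  qed
qed

section \<open>Measurability of the extended process\<close>

lemma measurable_enumerate:
  fixes A :: "'w \<Rightarrow> nat set"
  assumes "\<And>m. Measurable.pred \<Omega> (\<lambda>\<omega>. m \<in> A \<omega>)"
  shows "(\<lambda>\<omega>. enumerate (A \<omega>) i) \<in> measurable \<Omega> (count_space UNIV)"
  using assms
proof (induction i arbitrary: A)
  case 0
  note [measurable] = 0
  show ?case unfolding enumerate_0 by measurable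
next
  case (Suc i)
  note [measurable] = Suc.prems
  have "Measurable.pred \<Omega> (\<lambda>\<omega>. m \<in> A \<omega> - {LEAST n. n \<in> A \<omega>})" for m
    unfolding Diff_iff singleton_iff by measurable
  then show ?case
    unfolding enumerate_Suc by (rule Suc.IH)
qed

text \<open>
  Measurability is required on the whole space, including the null set on which observations are
  finite in number and the recursion fails. It is therefore derived from the definition itself, for
  arbitrary observation times, after rewriting the maximum as a least upper bound.
\<close>
lemma measurable_extended_process:
  assumes "T > 0" "\<sigma>0 \<in> {1..N}"
    and r: "\<And>k. r k \<in> measurable \<Omega> (count_space {1..N})"
    and s: "\<And>k. s k \<in> measurable \<Omega> (count_space {1..M})"
  shows "extended_process T \<tau>0 \<sigma>0 \<Lambda> r s k
    \<in> measurable \<Omega> (count_space ({1..N} \<times> {1..M} \<times> {1..N} \<times> {1..T}))"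
proof -
  have r' [measurable]: "r k \<in> measurable \<Omega> (count_space UNIV)" for k
    by (rule measurable_compose[OF r]) simp
  have [measurable]: "s k \<in> measurable \<Omega> (count_space UNIV)" for k
    by (rule measurable_compose[OF s]) simp
  have [measurable]: "(\<lambda>\<omega>. obs_times \<Lambda> s \<omega> i) \<in> measurable \<Omega> (count_space UNIV)" for i
    unfolding obs_times_def by (rule measurable_enumerate) simp
  define L where "L \<omega> = (LEAST m. \<forall>i. obs_times \<Lambda> s \<omega> i \<le> k \<longrightarrow> obs_times \<Lambda> s \<omega> i \<le> m)" for \<omega>
  have L [measurable]: "L \<in> measurable \<Omega> (count_space UNIV)"
    unfolding L_def by measurable
  have Max_eq: "Max {t i | i. t i \<le> k} = (LEAST m. \<forall>i. t i \<le> k \<longrightarrow> t i \<le> m)"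
    if "t 0 \<le> k" for t :: "nat \<Rightarrow> nat"
  proof -
    have "finite {t i | i. t i \<le> k}" "{t i | i. t i \<le> k} \<noteq> {}"
      using that by (auto intro: finite_subset[of _ "{..k}"])
    then show ?thesis
      by (intro Least_equality[symmetric]) (auto simp: intro: Max_ge)
  qed
  have \<tau>: "last_obs_time \<tau>0 (obs_times \<Lambda> s \<omega>) k =
      (if obs_times \<Lambda> s \<omega> 0 \<le> k then int (L \<omega>) else \<tau>0)" for \<omega>
    using Max_eq[of "obs_times \<Lambda> s \<omega>"] by (simp add: last_obs_time_def L_def)
  then have \<sigma>: "last_obs_state \<tau>0 \<sigma>0 (obs_times \<Lambda> s \<omega>) (\<lambda>l. r l \<omega>) k =
      (if obs_times \<Lambda> s \<omega> 0 \<le> k then r (L \<omega>) \<omega> else \<sigma>0)" for \<omega>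
    by (simp add: last_obs_state_def)
  have [measurable]: "(\<lambda>\<omega>. r (L \<omega>) \<omega>) \<in> measurable \<Omega> (count_space UNIV)"
    by (rule measurable_compose_countable[OF r' L])
  have "{\<omega> \<in> space \<Omega>. extended_process T \<tau>0 \<sigma>0 \<Lambda> r s k \<omega> = (a, b, c, d)} \<in> sets \<Omega>" for a b c d
    unfolding extended_process_def Let_def prod.inject \<sigma> \<tau> by measurable
  then have "extended_process T \<tau>0 \<sigma>0 \<Lambda> r s k -` {z} \<inter> space \<Omega> \<in> sets \<Omega>" for z
    by (cases z) (simp add: vimage_def Int_def conj_commute)
  moreover have "extended_process T \<tau>0 \<sigma>0 \<Lambda> r s k \<omega> \<in> {1..N} \<times> {1..M} \<times> {1..N} \<times> {1..T}"
    if "\<omega> \<in> space \<Omega>" for \<omega>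
    using measurable_space[OF r that] measurable_space[OF s that] assms(2) residue_in_props(1)[OF assms(1)]
    unfolding extended_process_def Let_def \<sigma> by auto
  ultimately show ?thesis
    by (subst measurable_count_space_eq_countable) auto
qed

section \<open>The extended process as a Markov chain\<close>

theorem mainTheorem1:
  fixes \<Omega> :: "'w measure"
    and r s :: "nat \<Rightarrow> 'w \<Rightarrow> nat"
    and P Q :: "nat \<Rightarrow> nat \<Rightarrow> real"
    and N M T r0 s0 \<sigma>0 :: nat
    and \<tau>0 :: int
    and \<Lambda> :: "nat set"
  assumes "prob_space \<Omega>"
    and "N > 0" and "M > 0" and "T > 0"
    and "markov_chain_from \<Omega> {1..N} P r0 r"
    and "markov_chain_from \<Omega> {1..M} Q s0 s"
    and "prob_space.indep_var \<Omega>
           (\<Pi>\<^sub>M k\<in>UNIV. count_space {1..N}) (\<lambda>\<omega> k. r k \<omega>)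
           (\<Pi>\<^sub>M k\<in>UNIV. count_space {1..M}) (\<lambda>\<omega> k. s k \<omega>)"
    and "\<Lambda> \<subseteq> {1..M}" and "\<Lambda> \<noteq> {}"
    and "recurrent_set {1..M} Q \<Lambda>"
    and "\<tau>0 < 0" and "\<sigma>0 \<in> {1..N}"
  shows "time_homogeneous_markov_chain \<Omega> ({1..N} \<times> {1..M} \<times> {1..N} \<times> {1..T})
           (extended_process T \<tau>0 \<sigma>0 \<Lambda> r s) \<and>
         has_transition_probs \<Omega> ({1..N} \<times> {1..M} \<times> {1..N} \<times> {1..T})
           (extended_process T \<tau>0 \<sigma>0 \<Lambda> r s)
           (\<lambda>(\<alpha>, \<beta>, \<gamma>, \<delta>) (\<alpha>', \<beta>', \<gamma>', \<delta>').
              if \<beta>' \<in> \<Lambda>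
              then of_bool (\<alpha>' = \<gamma>' \<and> \<delta>' = 1) * P \<alpha> \<alpha>' * Q \<beta> \<beta>'
              else of_bool (\<gamma>' = \<gamma> \<and> \<delta>' = residue_in T (int \<delta> + 1)) * P \<alpha> \<alpha>' * Q \<beta> \<beta>')"
proof -
  interpret prob_space \<Omega> by fact
  note r = assms(5) and s = assms(6) and indep = assms(7)
  let ?S = "{1..N} \<times> {1..M} \<times> {1..N} \<times> {1..T}"
  let ?X = "extended_process T \<tau>0 \<sigma>0 \<Lambda> r s"
  let ?upd = "extended_update T \<Lambda>"
  let ?K = "\<lambda>(\<alpha>, \<beta>, \<gamma>, \<delta>) (\<alpha>', \<beta>', \<gamma>', \<delta>').
              if \<beta>' \<in> \<Lambda>
              then of_bool (\<alpha>' = \<gamma>' \<and> \<delta>' = 1) * P \<alpha> \<alpha>' * Q \<beta> \<beta>'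
              else of_bool (\<gamma>' = \<gamma> \<and> \<delta>' = residue_in T (int \<delta> + 1)) * P \<alpha> \<alpha>' * Q \<beta> \<beta>'"
  let ?fst = "\<lambda>x i. fst (x i)" and ?snd = "\<lambda>x i. fst (snd (x i))"
  have r_meas: "r k \<in> measurable \<Omega> (count_space {1..N})" for k
    using r by (rule markov_chain_from_measurable)
  have s_meas: "s k \<in> measurable \<Omega> (count_space {1..M})" for k
    using s by (rule markov_chain_from_measurable)
  have X_meas: "?X k \<in> measurable \<Omega> (count_space ?S)" for k
    using \<open>T > 0\<close> \<open>\<sigma>0 \<in> {1..N}\<close> r_meas s_meas by (rule measurable_extended_process)
  note [measurable] = pred_eq_const_count_space[OF X_meas]
    pred_eq_const_count_space[OF r_meas] pred_eq_const_count_space[OF s_meas]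

  have joint: "\<P>(\<omega> in \<Omega>. (\<forall>i\<le>k. r i \<omega> = a i) \<and> (\<forall>i\<le>k. s i \<omega> = b i)) =
      \<P>(\<omega> in \<Omega>. \<forall>i\<le>k. r i \<omega> = a i) * \<P>(\<omega> in \<Omega>. \<forall>i\<le>k. s i \<omega> = b i)" for k a b
  proof -
    have coord: "(\<lambda>w. w i) \<in> measurable (\<Pi>\<^sub>M k\<in>(UNIV::nat set). count_space {1..n}) (count_space {1..n})"
      for i n :: nat
      by (rule measurable_component_singleton) simp
    note [measurable] = pred_eq_const_count_space[OF coord]
    let ?E = "\<lambda>n c. {w \<in> space (\<Pi>\<^sub>M k\<in>(UNIV::nat set). count_space {1..n}). \<forall>i\<le>k. w i = c i}"
    have "?E n c \<in> sets (\<Pi>\<^sub>M k\<in>(UNIV::nat set). count_space {1..n})" for n :: nat and c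
      by measurable
    from indep_varD[OF indep this this, of a b] show ?thesis
      using measurable_space[OF r_meas] measurable_space[OF s_meas]
      by (simp add: vimage_def Int_def space_PiM PiE_def Pi_def conj_ac cong: conj_cong)
  qed

  define compatible where "compatible x k \<longleftrightarrow>
      x 0 = ?upd (0, 0, \<sigma>0, residue_in T (- \<tau>0)) (?fst x 0) (?snd x 0) \<and>
      (\<forall>i<k. x (Suc i) = ?upd (x i) (?fst x (Suc i)) (?snd x (Suc i)))" for x and k :: nat
  have fst_X: "fst (?X k \<omega>) = r k \<omega>" and snd_X: "fst (snd (?X k \<omega>)) = s k \<omega>" for k \<omega>
    by (simp_all add: extended_process_def Let_def)
  have upd_fst: "fst (?upd u a b) = a" and upd_snd: "fst (snd (?upd u a b)) = b" for u a b
    by (simp_all add: extended_update_def split: prod.splits)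
  \<comment> \<open>The recursion makes the history of the extended process carry the same information as the
    histories of \<open>r\<close> and \<open>s\<close>, apart from the condition, not depending on chance, that the
    prescribed states be compatible with the recursion.\<close>
  have path_iff: "(\<forall>i\<le>k. ?X i \<omega> = x i) \<longleftrightarrow>
      compatible x k \<and> (\<forall>i\<le>k. r i \<omega> = ?fst x i) \<and> (\<forall>i\<le>k. s i \<omega> = ?snd x i)"
    if inf: "infinite {k. s k \<omega> \<in> \<Lambda>}" for k x \<omega>
  proof -
    have X_0: "?X 0 \<omega> = ?upd (0, 0, \<sigma>0, residue_in T (- \<tau>0)) (r 0 \<omega>) (s 0 \<omega>)"
      using \<open>T > 0\<close> inf by (rule extended_process_0)
    have X_Suc: "?X (Suc k) \<omega> = ?upd (?X k \<omega>) (r (Suc k) \<omega>) (s (Suc k) \<omega>)" for k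
      using \<open>T > 0\<close> inf by (rule extended_process_Suc)
    have X_Suc_iff: "?X (Suc k) \<omega> = x (Suc k) \<longleftrightarrow>
        x (Suc k) = ?upd (x k) (?fst x (Suc k)) (?snd x (Suc k)) \<and>
        r (Suc k) \<omega> = ?fst x (Suc k) \<and> s (Suc k) \<omega> = ?snd x (Suc k)"
      if "?X k \<omega> = x k" for k
      unfolding X_Suc that by (metis upd_fst upd_snd)
    show ?thesis
    proof (induction k)
      case 0
      show ?case
        using fst_X[of 0 \<omega>] snd_X[of 0 \<omega>] X_0 by (auto simp: compatible_def)
    next
      case (Suc k)
      have "(\<forall>i\<le>Suc k. ?X i \<omega> = x i) \<longleftrightarrow> (\<forall>i\<le>k. ?X i \<omega> = x i) \<and> ?X (Suc k) \<omega> = x (Suc k)"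
        by (auto simp: le_Suc_eq)
      also have "\<dots> \<longleftrightarrow> (\<forall>i\<le>k. ?X i \<omega> = x i) \<and>
          x (Suc k) = ?upd (x k) (?fst x (Suc k)) (?snd x (Suc k)) \<and>
          r (Suc k) \<omega> = ?fst x (Suc k) \<and> s (Suc k) \<omega> = ?snd x (Suc k)"
        using X_Suc_iff by blast
      also have "\<dots> \<longleftrightarrow> compatible x (Suc k) \<and>
          (\<forall>i\<le>Suc k. r i \<omega> = ?fst x i) \<and> (\<forall>i\<le>Suc k. s i \<omega> = ?snd x i)"
        unfolding Suc.IH by (auto simp: compatible_def less_Suc_eq le_Suc_eq)
      finally show ?case .
    qed
  qed

  \<comment> \<open>Recurrence makes the recursion hold outside a null set.\<close>
  have "AE \<omega> in \<Omega>. infinite {k. s k \<omega> \<in> \<Lambda>}"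
    using s \<open>recurrent_set {1..M} Q \<Lambda>\<close> by (intro recurrent_set_AE_infinite) auto
  then have "\<P>(\<omega> in \<Omega>. \<forall>i\<le>k. ?X i \<omega> = x i) =
      \<P>(\<omega> in \<Omega>. compatible x k \<and> (\<forall>i\<le>k. r i \<omega> = ?fst x i) \<and> (\<forall>i\<le>k. s i \<omega> = ?snd x i))" for x k
    by (intro prob_eq_AE) (auto simp: path_iff)
  then have path_prob: "\<P>(\<omega> in \<Omega>. \<forall>i\<le>k. ?X i \<omega> = x i) = of_bool (compatible x k) *
      (\<P>(\<omega> in \<Omega>. \<forall>i\<le>k. r i \<omega> = ?fst x i) * \<P>(\<omega> in \<Omega>. \<forall>i\<le>k. s i \<omega> = ?snd x i))" for x k
    by (simp add: joint)
  have K: "?K u v = of_bool (v = ?upd u (fst v) (fst (snd v))) *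
      (P (fst u) (fst v) * Q (fst (snd u)) (fst (snd v)))" for u v
    by (auto simp: extended_update_def split: prod.splits)
  show ?thesis
  proof (rule markov_chain_of_path_probs)
    fix k x assume x: "\<And>i. i \<le> Suc k \<Longrightarrow> x i \<in> ?S"
    have "compatible x (Suc k) \<longleftrightarrow>
        compatible x k \<and> x (Suc k) = ?upd (x k) (?fst x (Suc k)) (?snd x (Suc k))"
      by (auto simp: compatible_def less_Suc_eq)
    moreover have "\<P>(\<omega> in \<Omega>. \<forall>i\<le>Suc k. r i \<omega> = ?fst x i) =
        \<P>(\<omega> in \<Omega>. \<forall>i\<le>k. r i \<omega> = ?fst x i) * P (?fst x k) (?fst x (Suc k))"
      using x[of k] x[of "Suc k"] by (intro path_prob_Suc[OF r]) auto
    moreover have "\<P>(\<omega> in \<Omega>. \<forall>i\<le>Suc k. s i \<omega> = ?snd x i) =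
        \<P>(\<omega> in \<Omega>. \<forall>i\<le>k. s i \<omega> = ?snd x i) * Q (?snd x k) (?snd x (Suc k))"
      using x[of k] x[of "Suc k"] by (intro path_prob_Suc[OF s]) auto
    ultimately show "\<P>(\<omega> in \<Omega>. \<forall>i\<le>Suc k. ?X i \<omega> = x i) =
        \<P>(\<omega> in \<Omega>. \<forall>i\<le>k. ?X i \<omega> = x i) * ?K (x k) (x (Suc k))"
      unfolding path_prob K by (simp only: of_bool_conj mult_ac)
  qed (use X_meas in auto)
qed

end
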